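(* Let $G=(V,E)$ be a graph. The set of matchings $M(G)$ is the intersection of two matroids on $E$ if and only if $G$ contains no odd cycle of length at least $5$ and every triangle of $G$ has at most one vertex whose degree in $G$ is greater than $2$.
   Context: Graphs are finite, undirected, without loops or multiple edges. A matroid on a finite set $S$ is a family $\mathcal{M}$ of subsets of $S$ with $\emptyset\in\mathcal{M}$, closed under subsets, such that for every $A\subseteq S$ all maximal members of $\mathcal{M}$ contained in $A$ have the same cardinality. $M(G)$ denotes the family of all matchings of $G$ (sets of pairwise disjoint edges), as a family of subsets of $E$. The intersection of matroids $\mathcal{M}_1,\mathcal{M}_2$ on $E$ is $\mathcal{M}_1\cap\mathcal{M}_2$. A cycle of $G$ means a (not necessarily induced) cycle subgraph; a triangle is a cycle of length $3$. *)

theory Defs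
  imports Main
begin

definition simple_graph :: "'a set \<Rightarrow> 'a set set \<Rightarrow> bool" where
  "simple_graph V E \<longleftrightarrow> finite V \<and> (\<forall>e\<in>E. e \<subseteq> V \<and> card e = 2)"

definition degree :: "'a set set \<Rightarrow> 'a \<Rightarrow> nat" where
  "degree E v = card {e \<in> E. v \<in> e}"

definition matchings :: "'a set set \<Rightarrow> 'a set set set" where
  "matchings E = {M. M \<subseteq> E \<and> pairwise disjnt M}"

text \<open>A cycle subgraph is given by the list of its vertices in cyclic order; its length is
  the length of the list.\<close>

definition cycle :: "'a set set \<Rightarrow> 'a list \<Rightarrow> bool" where
  "cycle E vs \<longleftrightarrow> length vs \<ge> 3 \<and> distinct vs \<and>
     (\<forall>i < length vs. {vs ! i, vs ! (Suc i mod length vs)} \<in> E)"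

definition triangle :: "'a set set \<Rightarrow> 'a list \<Rightarrow> bool" where
  "triangle E vs \<longleftrightarrow> cycle E vs \<and> length vs = 3"

definition maximal_in :: "'e set set \<Rightarrow> 'e set \<Rightarrow> 'e set \<Rightarrow> bool" where
  "maximal_in \<M> A X \<longleftrightarrow> X \<in> \<M> \<and> X \<subseteq> A \<and> (\<forall>Y\<in>\<M>. Y \<subseteq> A \<longrightarrow> X \<subseteq> Y \<longrightarrow> Y = X)"

definition matroid :: "'e set \<Rightarrow> 'e set set \<Rightarrow> bool" where
  "matroid S \<M> \<longleftrightarrow> finite S \<and> \<M> \<subseteq> Pow S \<and> {} \<in> \<M> \<and>
     (\<forall>X\<in>\<M>. \<forall>Y\<subseteq>X. Y \<in> \<M>) \<and>
     (\<forall>A\<subseteq>S. \<forall>X Y. maximal_in \<M> A X \<longrightarrow> maximal_in \<M> A Y \<longrightarrow> card X = card Y)"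

end

theory Submission
  imports Defs
begin

text \<open>Parallelism of non-loops in a matroid is an equivalence relation, and a partition matroid
  realises any prescribed one. Since a matching is determined by its pairs, the matchings of a
  graph form an intersection of two matroids iff adjacency of edges is the union of two
  equivalence relations. Along a cycle of length at least 4 the two relations must alternate, so
  odd cycles of length at least 5 are impossible, and a case analysis excludes triangles with two
  vertices of degree at least 3. Conversely, take a maximal subgraph without odd cycles among
  those that miss only edges whose two ends have degree at most 2, and 2-colour it. By maximality
  each monochromatic edge of the graph closes a triangle whose apex has the other colour. Grouping
  the edges by their end vertex of a given colour, where the two ends of a monochromatic edge are
  identified, yields the two partition matroids.\<close>

section \<open>Matroids and parallel elements\<close>

lemma partition_matroid:
  assumes "finite E"
  shows "matroid E {X. X \<subseteq> E \<and> inj_on f X}"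
proof -
  have "card X = card (f ` A)" if A: "A \<subseteq> E" and X: "maximal_in {X. X \<subseteq> E \<and> inj_on f X} A X"
    for A X
  proof -
    from X have inj: "inj_on f X" and XA: "X \<subseteq> A"
      and mx: "\<And>Y. Y \<subseteq> E \<Longrightarrow> inj_on f Y \<Longrightarrow> Y \<subseteq> A \<Longrightarrow> X \<subseteq> Y \<Longrightarrow> Y = X"
      unfolding maximal_in_def by blast+
    have "f a \<in> f ` X" if "a \<in> A" for a
    proof (rule ccontr)
      assume a: "f a \<notin> f ` X"
      then have "inj_on f (insert a X)" using inj by (auto simp: inj_on_insert)
      then have "insert a X = X" using mx[of "insert a X"] A XA that by blast
      then show False using a by blast
    qed
    then have "f ` X = f ` A" using XA by blast
    then show ?thesis using card_image[OF inj] by simp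
  qed
  then have "card X = card Y"
    if "A \<subseteq> E" "maximal_in {X. X \<subseteq> E \<and> inj_on f X} A X"
      "maximal_in {X. X \<subseteq> E \<and> inj_on f X} A Y" for A X Y
    using that by metis
  moreover have "Y \<in> {X. X \<subseteq> E \<and> inj_on f X}" if "X \<in> {X. X \<subseteq> E \<and> inj_on f X}" "Y \<subseteq> X" for X Y
    using that inj_on_subset by blast
  moreover have "{X. X \<subseteq> E \<and> inj_on f X} \<subseteq> Pow E" "{} \<in> {X. X \<subseteq> E \<and> inj_on f X}"
    by auto
  ultimately show ?thesis
    unfolding matroid_def using assms by blast
qed

text \<open>If \<open>{e, g}\<close> were independent, then \<open>{f}\<close> and
  \<open>{e, g}\<close> would both be maximal in \<open>{e, f, g}\<close> but of different sizes.
  Independence of \<open>{f}\<close> matters: a loop is dependent with everything.\<close>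

lemma matroid_parallel_trans:
  assumes "matroid E M" and "{f} \<in> M"
    and "e \<noteq> g" and "{e, f} \<notin> M" and "{f, g} \<notin> M"
  shows "{e, g} \<notin> M"
proof
  assume eg: "{e, g} \<in> M"
  have sub: "\<And>X Y. X \<in> M \<Longrightarrow> Y \<subseteq> X \<Longrightarrow> Y \<in> M"
    using assms(1) unfolding matroid_def by simp
  have ME: "M \<subseteq> Pow E"
    using assms(1) unfolding matroid_def by simp
  have eq: "\<forall>A\<subseteq>E. \<forall>X Y. maximal_in M A X \<longrightarrow> maximal_in M A Y \<longrightarrow> card X = card Y"
    using assms(1) unfolding matroid_def by (elim conjE)
  have AE: "{e, f, g} \<subseteq> E" using ME eg assms(2) by blast
  have no: "Y = {f}" if "Y \<in> M" "f \<in> Y" "Y \<subseteq> {e, f, g}" for Y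
  proof -
    have "e \<notin> Y" "g \<notin> Y"
      using sub[OF that(1), of "{e, f}"] sub[OF that(1), of "{f, g}"] that(2) assms(4,5) by auto
    then show ?thesis using that(2,3) by auto
  qed
  have "maximal_in M {e, f, g} {f}"
    unfolding maximal_in_def using assms(2) by (auto dest: no)
  moreover have "maximal_in M {e, f, g} {e, g}"
    unfolding maximal_in_def
  proof (intro conjI ballI impI)
    fix Y assume Y: "Y \<in> M" "Y \<subseteq> {e, f, g}" "{e, g} \<subseteq> Y"
    have "f \<notin> Y" using no[OF Y(1) _ Y(2)] Y(3) assms(3) by auto
    then show "Y = {e, g}" using Y(2,3) by auto
  qed (use eg in auto)
  ultimately have "card {f} = card {e, g}" using eq AE by meson
  then show False using assms(3) by simp
qed

lemma matroid_parallel_classes: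
  fixes E :: "'e set"
  assumes "matroid E M" and single: "\<And>e. e \<in> E \<Longrightarrow> {e} \<in> M"
  obtains f :: "'e \<Rightarrow> 'e set"
  where "\<And>e g. e \<in> E \<Longrightarrow> g \<in> E \<Longrightarrow> e \<noteq> g \<Longrightarrow> f e = f g \<longleftrightarrow> {e, g} \<notin> M"
proof
  \<comment> \<open>The label of \<open>e\<close> is its parallel class. The disjunct
    \<open>x = e\<close> is there because \<open>{e, e}\<close> is the independent set
    \<open>{e}\<close>.\<close>
  let ?f = "\<lambda>e. {x \<in> E. x = e \<or> {e, x} \<notin> M}"
  fix e g assume e: "e \<in> E" and g: "g \<in> E" and ne: "e \<noteq> g"
  show "?f e = ?f g \<longleftrightarrow> {e, g} \<notin> M"
  proof
    assume "?f e = ?f g"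
    then have "g \<in> ?f e" using g by blast
    then show "{e, g} \<notin> M" using ne by auto
  next
    assume eg: "{e, g} \<notin> M"
    have "x \<in> ?f b" if "x \<in> ?f a" "{a, b} \<notin> M" "a \<in> E" for a b x
    proof -
      have "{b, a} \<notin> M" using that by (simp add: insert_commute)
      then show ?thesis
        using that matroid_parallel_trans[OF assms(1) single[OF that(3)], of b x] by auto
    qed
    note sub = this
    have ge: "{g, e} \<notin> M" using eg by (simp add: insert_commute)
    show "?f e = ?f g"
    proof (rule equalityI)
      show "?f e \<subseteq> ?f g" by (rule subsetI) (rule sub[OF _ eg e])
      show "?f g \<subseteq> ?f e" by (rule subsetI) (rule sub[OF _ ge g])
    qed
  qed
qed

text \<open>Single edges are matchings, so neither matroid has loops on \<open>E\<close>. Two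
  distinct edges meet iff their pair is no matching, that is, iff they are parallel in one of the
  matroids.\<close>

lemma matchings_intersection_imp_classes:
  fixes E :: "'a set set"
  assumes "matroid E M1" "matroid E M2" "matchings E = M1 \<inter> M2"
  obtains f1 f2 :: "'a set \<Rightarrow> 'a set set"
  where "\<And>e g. e \<in> E \<Longrightarrow> g \<in> E \<Longrightarrow> e \<noteq> g \<Longrightarrow> e \<inter> g \<noteq> {} \<longleftrightarrow> f1 e = f1 g \<or> f2 e = f2 g"
proof -
  have "{e} \<in> M1 \<inter> M2" if "e \<in> E" for e
    using that unfolding assms(3)[symmetric] matchings_def by simp
  then have single: "\<And>e. e \<in> E \<Longrightarrow> {e} \<in> M1" "\<And>e. e \<in> E \<Longrightarrow> {e} \<in> M2" by blast+
  obtain f1 :: "'a set \<Rightarrow> 'a set set"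
    where f1: "\<And>e g. e \<in> E \<Longrightarrow> g \<in> E \<Longrightarrow> e \<noteq> g \<Longrightarrow> f1 e = f1 g \<longleftrightarrow> {e, g} \<notin> M1"
    using matroid_parallel_classes[OF assms(1) single(1)] by blast
  obtain f2 :: "'a set \<Rightarrow> 'a set set"
    where f2: "\<And>e g. e \<in> E \<Longrightarrow> g \<in> E \<Longrightarrow> e \<noteq> g \<Longrightarrow> f2 e = f2 g \<longleftrightarrow> {e, g} \<notin> M2"
    using matroid_parallel_classes[OF assms(2) single(2)] by blast
  have pair: "e \<inter> g \<noteq> {} \<longleftrightarrow> {e, g} \<notin> M1 \<inter> M2" if "e \<in> E" "g \<in> E" "e \<noteq> g" for e g
    using that unfolding assms(3)[symmetric] matchings_def
    by (auto simp: pairwise_def disjnt_def)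
  show ?thesis
    by (rule that[of f1 f2]) (simp add: f1 f2 pair)
qed

text \<open>Disjointness and injectivity are both conditions on pairs of edges, so agreement on
  pairs gives equality of the families.\<close>

lemma classes_imp_matchings_intersection:
  assumes "finite E"
    and "\<And>e g. e \<in> E \<Longrightarrow> g \<in> E \<Longrightarrow> e \<noteq> g \<Longrightarrow> e \<inter> g \<noteq> {} \<longleftrightarrow> f1 e = f1 g \<or> f2 e = f2 g"
  shows "\<exists>M1 M2. matroid E M1 \<and> matroid E M2 \<and> matchings E = M1 \<inter> M2"
proof (intro exI conjI)
  show "matroid E {X. X \<subseteq> E \<and> inj_on f1 X}" "matroid E {X. X \<subseteq> E \<and> inj_on f2 X}"
    using partition_matroid[OF assms(1)] by blast+
  have "pairwise disjnt X \<longleftrightarrow> inj_on f1 X \<and> inj_on f2 X" if "X \<subseteq> E" for X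
    using that assms(2) unfolding pairwise_def disjnt_def inj_on_def by (meson subsetD)
  then show "matchings E = {X. X \<subseteq> E \<and> inj_on f1 X} \<inter> {X. X \<subseteq> E \<and> inj_on f2 X}"
    unfolding matchings_def by auto
qed

section \<open>Necessity\<close>

lemma classes_imp_no_odd_cycle:
  assumes cls: "\<And>e g. e \<in> E \<Longrightarrow> g \<in> E \<Longrightarrow> e \<noteq> g \<Longrightarrow> e \<inter> g \<noteq> {} \<longleftrightarrow> f1 e = f1 g \<or> f2 e = f2 g"
    and "cycle E vs" and "length vs \<ge> 5"
  shows "even (length vs)"
proof -
  define n where "n = length vs"
  \<comment> \<open>Indices are read modulo \<open>n\<close>, so closing the cycle needs no separate
    case.\<close>
  define v where "v k = vs ! (k mod n)" for k
  define e where "e k = {v k, v (Suc k)}" for k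
  have n5: "n \<ge> 5" and dist: "distinct vs"
    using assms(2,3) by (auto simp: n_def cycle_def)
  have eE: "e k \<in> E" for k
    using assms(2) n5 unfolding cycle_def e_def v_def n_def[symmetric]
    by (metis mod_Suc_eq mod_less_divisor not_numeral_le_zero zero_less_iff_neq_zero)
  have v_eq: "v j = v k \<longleftrightarrow> j mod n = k mod n" for j k
    unfolding v_def using dist n5 by (subst nth_eq_iff_index_eq) (auto simp: n_def[symmetric])
  have v_ne: "v k \<noteq> v (k + d)" if "0 < d" "d < n" for k d
  proof
    assume "v k = v (k + d)"
    then have "n dvd (k + d) - k" unfolding v_eq by (metis le_add1 mod_eq_dvd_iff_nat)
    then show False using that by (auto dest: dvd_imp_le)
  qed
  \<comment> \<open>Distance 3 counts too: the outer ends of \<open>e k\<close> and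
    \<open>e (Suc (Suc k))\<close> are three apart and would coincide in a triangle.\<close>
  have ne: "v k \<noteq> v (Suc k)" "v k \<noteq> v (Suc (Suc k))" "v k \<noteq> v (Suc (Suc (Suc k)))" for k
    using v_ne[of 1 k] v_ne[of 2 k] v_ne[of 3 k] n5 by (simp_all add: numeral_eq_Suc)
  have adj: "f1 (e k) = f1 (e (Suc k)) \<or> f2 (e k) = f2 (e (Suc k))" for k
  proof -
    have "e k \<noteq> e (Suc k)" "e k \<inter> e (Suc k) \<noteq> {}"
      using ne[of k] unfolding e_def by (auto simp: doubleton_eq_iff)
    then show ?thesis using cls eE by blast
  qed
  have nadj: "f1 (e k) \<noteq> f1 (e (Suc (Suc k)))" "f2 (e k) \<noteq> f2 (e (Suc (Suc k)))" for k
  proof -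
    have "e k \<noteq> e (Suc (Suc k))" "e k \<inter> e (Suc (Suc k)) = {}"
      using ne[of k] ne[of "Suc k"] unfolding e_def by (auto simp: doubleton_eq_iff)
    then show "f1 (e k) \<noteq> f1 (e (Suc (Suc k)))" "f2 (e k) \<noteq> f2 (e (Suc (Suc k)))"
      using cls eE by blast+
  qed
  define P where "P k \<longleftrightarrow> f1 (e k) = f1 (e (Suc k))" for k
  \<comment> \<open>Two agreements in a row under the same function would make the disjoint edges
    \<open>e k\<close> and \<open>e (Suc (Suc k))\<close> agree.\<close>
  have "P (Suc k) \<longleftrightarrow> \<not> P k" for k
    using adj[of k] adj[of "Suc k"] nadj[of k] unfolding P_def by metis
  then have alt: "P k \<longleftrightarrow> (P 0 \<longleftrightarrow> even k)" for k
    by (induction k) auto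
  have "v (n + k) = v k" for k by (simp add: v_def)
  then have "e (n + k) = e k" for k unfolding e_def by (metis add_Suc_right)
  then have "P n \<longleftrightarrow> P 0" unfolding P_def by (metis add.right_neutral add_Suc_right)
  then show ?thesis using alt[of n] by (auto simp: n_def)
qed

lemma degree_gt_2_obtains_third_edge:
  assumes "\<And>e. e \<in> E \<Longrightarrow> card e = 2" and "degree E a > 2"
  obtains x where "{a, x} \<in> E" "x \<noteq> a" "x \<noteq> b" "x \<noteq> c"
proof -
  have "\<not> {e \<in> E. a \<in> e} \<subseteq> {{a, b}, {a, c}}"
  proof
    assume "{e \<in> E. a \<in> e} \<subseteq> {{a, b}, {a, c}}"
    then have "degree E a \<le> card {{a, b}, {a, c}}"
      unfolding degree_def by (intro card_mono) auto
    also have "\<dots> \<le> 2" by (simp add: card_insert_if)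
    finally show False using assms(2) by simp
  qed
  then obtain e where e: "e \<in> E" "a \<in> e" "e \<noteq> {a, b}" "e \<noteq> {a, c}" by blast
  then obtain x where "e = {a, x}" "x \<noteq> a"
    using assms(1)[OF e(1)] by (metis card_2_iff doubleton_eq_iff insertE singletonD)
  then show ?thesis using that e by blast
qed

lemma classes_imp_triangle_degree:
  assumes cls: "\<And>e g. e \<in> E \<Longrightarrow> g \<in> E \<Longrightarrow> e \<noteq> g \<Longrightarrow> e \<inter> g \<noteq> {} \<longleftrightarrow> f1 e = f1 g \<or> f2 e = f2 g"
    and card2: "\<And>e. e \<in> E \<Longrightarrow> card e = 2"
    and tri: "{a, b} \<in> E" "{b, c} \<in> E" "{a, c} \<in> E"
    and "degree E a > 2"
  shows "degree E b \<le> 2"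
proof (rule ccontr)
  assume "\<not> degree E b \<le> 2"
  then obtain y where y: "{b, y} \<in> E" "y \<noteq> b" "y \<noteq> a" "y \<noteq> c"
    using degree_gt_2_obtains_third_edge[OF card2] by (metis not_le)
  obtain x where x: "{a, x} \<in> E" "x \<noteq> a" "x \<noteq> b" "x \<noteq> c"
    using degree_gt_2_obtains_third_edge[OF card2 \<open>degree E a > 2\<close>] by metis
  have d: "a \<noteq> b" "b \<noteq> c" "a \<noteq> c" using card2 tri by force+
  note xs = d d[symmetric] x(2-4) x(2-4)[symmetric] y(2-4) y(2-4)[symmetric]
  \<comment> \<open>Facts 1 to 9 compare the triangle edges with each other and with the extra edges
    at \<open>a\<close> and \<open>b\<close>. The two extra edges are not compared, since
    \<open>x = y\<close> is possible.\<close>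
  have 1: "f1 {a, x} = f1 {a, b} \<or> f2 {a, x} = f2 {a, b}"
    using cls[OF x(1) tri(1)] xs by (auto simp: doubleton_eq_iff)
  have 2: "f1 {a, x} = f1 {a, c} \<or> f2 {a, x} = f2 {a, c}"
    using cls[OF x(1) tri(3)] xs by (auto simp: doubleton_eq_iff)
  have 3: "f1 {a, x} \<noteq> f1 {b, c} \<and> f2 {a, x} \<noteq> f2 {b, c}"
    using cls[OF x(1) tri(2)] xs by (auto simp: doubleton_eq_iff)
  have 4: "f1 {b, y} = f1 {a, b} \<or> f2 {b, y} = f2 {a, b}"
    using cls[OF y(1) tri(1)] xs by (auto simp: doubleton_eq_iff)
  have 5: "f1 {b, y} = f1 {b, c} \<or> f2 {b, y} = f2 {b, c}"
    using cls[OF y(1) tri(2)] xs by (auto simp: doubleton_eq_iff)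
  have 6: "f1 {b, y} \<noteq> f1 {a, c} \<and> f2 {b, y} \<noteq> f2 {a, c}"
    using cls[OF y(1) tri(3)] xs by (auto simp: doubleton_eq_iff)
  have 7: "f1 {a, b} = f1 {b, c} \<or> f2 {a, b} = f2 {b, c}"
    using cls[OF tri(1,2)] xs by (auto simp: doubleton_eq_iff)
  have 8: "f1 {a, b} = f1 {a, c} \<or> f2 {a, b} = f2 {a, c}"
    using cls[OF tri(1,3)] xs by (auto simp: doubleton_eq_iff)
  have 9: "f1 {b, c} = f1 {a, c} \<or> f2 {b, c} = f2 {a, c}"
    using cls[OF tri(2,3)] xs by (auto simp: doubleton_eq_iff)
  \<comment> \<open>By symmetry let ab and bc agree under \<open>f1\<close> (7). Then ax and ab
    agree under \<open>f2\<close> (1, 3). If ab and ac agree under \<open>f1\<close>, then ax and ac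
    must agree under \<open>f2\<close> (2, 3), so ab and ac do too, and 4 contradicts 6. If they
    agree under \<open>f2\<close>, then by and ab agree under \<open>f1\<close> (4, 6), and either
    case of 9 contradicts 6 or 3.\<close>
  show False using 1 2 3 4 5 6 7 8 9 by metis
qed

lemma triangle_iff:
  "triangle E [a, b, c] \<longleftrightarrow>
     a \<noteq> b \<and> b \<noteq> c \<and> a \<noteq> c \<and> {a, b} \<in> E \<and> {b, c} \<in> E \<and> {a, c} \<in> E"
proof -
  have "(\<forall>i < length [a, b, c]. {[a, b, c] ! i, [a, b, c] ! (Suc i mod length [a, b, c])} \<in> E) \<longleftrightarrow>
      {a, b} \<in> E \<and> {b, c} \<in> E \<and> {c, a} \<in> E"
    by (simp add: All_less_Suc conj_ac)
  then show ?thesis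
    unfolding triangle_def cycle_def by (auto simp: insert_commute[of c a])
qed

lemma triangle_obtains:
  assumes "triangle E vs"
  obtains a b c where "vs = [a, b, c]"
  using assms unfolding triangle_def by (auto simp: numeral_eq_Suc length_Suc_conv)

section \<open>Bipartite graphs\<close>

lemma rtrancl_obtains_path:
  assumes "(x, y) \<in> {(u, v). {u, v} \<in> E}\<^sup>*"
  obtains vs where "vs \<noteq> []" "distinct vs" "hd vs = x" "last vs = y"
    "\<forall>i. Suc i < length vs \<longrightarrow> {vs ! i, vs ! Suc i} \<in> E"
proof -
  have "\<exists>vs. vs \<noteq> [] \<and> distinct vs \<and> hd vs = x \<and> last vs = y \<and>
    (\<forall>i. Suc i < length vs \<longrightarrow> {vs ! i, vs ! Suc i} \<in> E)"
    using assms
  proof (induction rule: rtrancl_induct)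
    case base
    show ?case by (rule exI[of _ "[x]"]) simp
  next
    case (step y z)
    then obtain vs where vs: "vs \<noteq> []" "distinct vs" "hd vs = x" "last vs = y"
      "\<And>i. Suc i < length vs \<Longrightarrow> {vs ! i, vs ! Suc i} \<in> E" and yz: "{y, z} \<in> E"
      by blast
    show ?case
    proof (cases "z \<in> set vs")
      case True
      then obtain k where k: "k < length vs" "vs ! k = z" by (auto simp: in_set_conv_nth)
      \<comment> \<open>The walk has returned to a visited vertex, so the path is cut back to end
        there.\<close>
      show ?thesis
        using vs k
        by (intro exI[of _ "take (Suc k) vs"])
          (auto simp: hd_conv_nth last_conv_nth min_absorb2)
    next
      case False
      have "{(vs @ [z]) ! i, (vs @ [z]) ! Suc i} \<in> E" if "Suc i < length (vs @ [z])" for i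
      proof (cases "Suc i < length vs")
        case True
        then show ?thesis using vs(5)[of i] by (simp add: nth_append)
      next
        case False
        then have "Suc i = length vs" using that by simp
        moreover from this have "vs ! i = y" using vs(1,4) by (metis diff_Suc_1 last_conv_nth)
        ultimately show ?thesis using yz by (simp add: nth_append)
      qed
      then show ?thesis
        using vs False by (intro exI[of _ "vs @ [z]"]) auto
    qed
  qed
  then show ?thesis using that by blast
qed

lemma cycle_mono: "cycle E vs \<Longrightarrow> E \<subseteq> F \<Longrightarrow> cycle F vs"
  unfolding cycle_def by blast

text \<open>Edges are added one at a time. If the ends \<open>u\<close> and \<open>v\<close> of the
  new edge have equal colours, they lie in different components, since a path between them would
  close to an odd cycle; flipping the colours on the component of \<open>u\<close> repairs the
  colouring.\<close>

lemma no_odd_cycle_imp_two_colouring: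
  assumes "finite E" and "\<And>e. e \<in> E \<Longrightarrow> card e = 2"
    and "\<And>vs. cycle E vs \<Longrightarrow> even (length vs)"
  shows "\<exists>c :: 'a \<Rightarrow> bool. \<forall>x y. {x, y} \<in> E \<longrightarrow> c x \<noteq> c y"
  using assms
proof (induction E rule: finite_induct)
  case empty
  then show ?case by simp
next
  case (insert e E)
  from insert.prems(2) have ev: "even (length vs)" if "cycle E vs" for vs
    using cycle_mono[OF that, of "insert e E"] by blast
  then obtain c where c: "\<And>x y. {x, y} \<in> E \<Longrightarrow> c x \<noteq> (c y :: bool)"
    using insert.IH insert.prems(1) by (metis insertCI)
  obtain u v where e: "e = {u, v}" "u \<noteq> v"
    using insert.prems(1)[of e] by (auto simp: card_2_iff)
  let ?R = "{(u, v). {u, v} \<in> E}"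
  show ?case
  proof (cases "c u = c v")
    case False
    then show ?thesis using c e by (intro exI[of _ c]) (auto simp: doubleton_eq_iff)
  next
    case True
    have "(u, v) \<notin> ?R\<^sup>*"
    proof
      assume "(u, v) \<in> ?R\<^sup>*"
      then obtain vs where vs: "vs \<noteq> []" "distinct vs" "hd vs = u" "last vs = v"
        and edge: "\<And>i. Suc i < length vs \<Longrightarrow> {vs ! i, vs ! Suc i} \<in> E"
        by (rule rtrancl_obtains_path) blast
      have alt: "c (vs ! i) \<longleftrightarrow> (c u \<longleftrightarrow> even i)" if "i < length vs" for i
        using that
      proof (induction i)
        case 0
        then show ?case using vs by (simp add: hd_conv_nth)
      next
        case (Suc i)
        then show ?case using c[OF edge[of i]] by auto
      qed
      have last: "vs ! (length vs - 1) = v" using vs by (simp add: last_conv_nth)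
      \<comment> \<open>Colours alternate along the path and its ends agree, so it has an odd number
        of vertices.\<close>
      then have odd: "odd (length vs)"
        using alt[of "length vs - 1"] vs(1) True by (cases vs) auto
      have "length vs \<noteq> 1" using vs e(2) by (auto simp: length_Suc_conv)
      with odd have len: "length vs \<ge> 3" by presburger
      have "{vs ! i, vs ! (Suc i mod length vs)} \<in> insert e E" if "i < length vs" for i
      proof (cases "Suc i < length vs")
        case True
        then show ?thesis using edge by simp
      next
        case False
        then have "i = length vs - 1" "Suc i = length vs" using that by auto
        \<comment> \<open>The last index wraps around to 0, and the closing edge is the new
          one.\<close>
        then show ?thesis using last vs e by (auto simp: hd_conv_nth)
      qed
      then have "cycle (insert e E) vs" using len vs(2) by (simp add: cycle_def)
      then show False using insert.prems(2) odd by blast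
    qed
    \<comment> \<open>No edge of \<open>E\<close> leaves the component, so flipping it keeps every
      old edge two-coloured.\<close>
    moreover have "(u, x) \<in> ?R\<^sup>* \<longleftrightarrow> (u, y) \<in> ?R\<^sup>*" if "{x, y} \<in> E" for x y
      using that by (auto simp: insert_commute intro: rtrancl_into_rtrancl)
    ultimately show ?thesis
      using c e True
      by (intro exI[of _ "\<lambda>x. if (u, x) \<in> ?R\<^sup>* then \<not> c x else c x"])
        (auto simp: doubleton_eq_iff)
  qed
qed

section \<open>Sufficiency\<close>

text \<open>The two given edges are distinct and already exhaust the degree of
  \<open>x\<close>.\<close>

lemma degree_le_2_edges:
  assumes "finite E" "degree E x \<le> 2" "{a, x} \<in> E" "{x, y} \<in> E" "a \<noteq> y" "e \<in> E" "x \<in> e"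
  shows "e = {a, x} \<or> e = {x, y}"
proof -
  have "{a, x} \<noteq> {x, y}" using assms(5) by (metis doubleton_eq_iff)
  then have "card {{a, x}, {x, y}} = 2" by simp
  then have "{{a, x}, {x, y}} = {e \<in> E. x \<in> e}"
    using assms by (intro card_seteq) (auto simp: degree_def)
  then show ?thesis using assms(6,7) by blast
qed

lemma two_colouring_up_to_triangle_bases:
  assumes "finite E" and card2: "\<And>e. e \<in> E \<Longrightarrow> card e = 2"
    and odd3: "\<And>vs. cycle E vs \<Longrightarrow> odd (length vs) \<Longrightarrow> length vs < 5"
    and tri: "\<And>vs. triangle E vs \<Longrightarrow> card {v \<in> set vs. degree E v > 2} \<le> 1"
  obtains c :: "'a \<Rightarrow> bool" where "\<And>x y. {x, y} \<in> E \<Longrightarrow> c x = c y \<Longrightarrow>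
    degree E x \<le> 2 \<and> degree E y \<le> 2 \<and> (\<exists>a. {a, x} \<in> E \<and> {a, y} \<in> E \<and> c a \<noteq> c x)"
proof -
  define B where "B = {{x, y} | x y. {x, y} \<in> E \<and> degree E x \<le> 2 \<and> degree E y \<le> 2}"
  have odd_tri: "triangle E vs" if "cycle E vs" "odd (length vs)" for vs
  proof -
    have "3 \<le> length vs" using that(1) by (simp add: cycle_def)
    moreover have "length vs \<noteq> 4" using that(2) by auto
    ultimately show ?thesis using odd3[OF that] that(1) by (simp add: triangle_def)
  qed
  define \<F> where "\<F> = {F. E - B \<subseteq> F \<and> F \<subseteq> E \<and> (\<forall>vs. cycle F vs \<longrightarrow> even (length vs))}"
  \<comment> \<open>An odd cycle is a triangle, and two of its vertices have degree at most 2. The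
    edge between them lies in \<open>B\<close>, so no odd cycle survives in
    \<open>E - B\<close>.\<close>
  have "E - B \<in> \<F>"
  proof -
    have "even (length vs)" if cyc: "cycle (E - B) vs" for vs
    proof (rule ccontr)
      assume "odd (length vs)"
      then have t: "triangle E vs" "triangle (E - B) vs"
        using cycle_mono[OF cyc, of E] cyc odd_tri by (auto simp: triangle_def)
      then obtain p q r where vs: "vs = [p, q, r]" by (auto elim: triangle_obtains)
      have d: "p \<noteq> q" "q \<noteq> r" "p \<noteq> r" and nB: "{p, q} \<notin> B" "{q, r} \<notin> B" "{p, r} \<notin> B"
        and inE: "{p, q} \<in> E" "{q, r} \<in> E" "{p, r} \<in> E"
        using t(2) unfolding vs triangle_iff by auto
      have two: False if "S \<subseteq> {v \<in> set vs. degree E v > 2}" "card S = 2" for S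
        using card_mono[OF _ that(1)] tri[OF t(1)] that(2) by simp
      have "degree E p \<le> 2 \<or> degree E q \<le> 2" "degree E q \<le> 2 \<or> degree E r \<le> 2"
        "degree E p \<le> 2 \<or> degree E r \<le> 2"
        using two[of "{p, q}"] two[of "{q, r}"] two[of "{p, r}"] d by (force simp: vs not_le)+
      then show False using nB inE unfolding B_def by blast
    qed
    then show ?thesis unfolding \<F>_def by blast
  qed
  moreover have "finite \<F>"
    by (rule finite_subset[of _ "Pow E"]) (auto simp: \<F>_def assms(1))
  ultimately obtain F where F: "F \<in> \<F>" and mx: "\<And>F'. F' \<in> \<F> \<Longrightarrow> F \<subseteq> F' \<Longrightarrow> F = F'"
    using finite_has_maximal2 by metis
  have FE: "F \<subseteq> E" and BF: "E - B \<subseteq> F" and ev: "\<And>vs. cycle F vs \<Longrightarrow> even (length vs)"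
    using F by (auto simp: \<F>_def)
  have "finite F" using FE assms(1) finite_subset by blast
  then obtain c :: "'a \<Rightarrow> bool" where c: "\<And>x y. {x, y} \<in> F \<Longrightarrow> c x \<noteq> c y"
    using no_odd_cycle_imp_two_colouring[of F] card2 FE ev by (metis subsetD)
  show ?thesis
  proof (rule that[of c])
    fix x y assume xy: "{x, y} \<in> E" and cxy: "c x = c y"
    then have nF: "{x, y} \<notin> F" using c by blast
    then have "insert {x, y} F \<notin> \<F>" using mx[of "insert {x, y} F"] by blast
    then obtain vs where cyc: "cycle (insert {x, y} F) vs" and odd: "odd (length vs)"
      using BF FE xy by (auto simp: \<F>_def)
    have "cycle E vs" using cycle_mono[OF cyc] FE xy by blast
    then have t: "triangle (insert {x, y} F) vs"
      using odd_tri[OF _ odd] cyc by (simp add: triangle_def)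
    then obtain p q r where vs: "vs = [p, q, r]" by (auto elim: triangle_obtains)
    \<comment> \<open>The triangle must use the new edge, so its other two sides lie in
      \<open>F\<close> and join \<open>x\<close> and \<open>y\<close> to an apex of the opposite
      colour.\<close>
    have "\<not> triangle F vs" using ev odd by (auto simp: triangle_def)
    then have "\<exists>a. {a, x} \<in> F \<and> {a, y} \<in> F"
      using t nF unfolding vs triangle_iff by (auto simp: doubleton_eq_iff insert_commute)
    then obtain a where a: "{a, x} \<in> F" "{a, y} \<in> F" by blast
    have "{x, y} \<in> B" using nF BF xy by blast
    then have "degree E x \<le> 2" "degree E y \<le> 2"
      unfolding B_def by (auto simp: doubleton_eq_iff)
    then show "degree E x \<le> 2 \<and> degree E y \<le> 2 \<and> (\<exists>a. {a, x} \<in> E \<and> {a, y} \<in> E \<and> c a \<noteq> c x)"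
      using a c[OF a(1)] FE by blast
  qed
qed

text \<open>The class \<open>f i\<close> groups edges by their end of colour \<open>i\<close>.
  Identifying the ends \<open>x\<close>, \<open>y\<close> of a monochromatic edge creates no false
  agreement: every edge at \<open>x\<close> or \<open>y\<close> belongs to one triangle, and any two
  edges of a triangle meet.\<close>

lemma two_colouring_imp_classes:
  fixes E :: "'a set set" and c :: "'a \<Rightarrow> bool"
  assumes "finite E" and card2: "\<And>e. e \<in> E \<Longrightarrow> card e = 2"
    and col: "\<And>x y. {x, y} \<in> E \<Longrightarrow> c x = c y \<Longrightarrow>
      degree E x \<le> 2 \<and> degree E y \<le> 2 \<and> (\<exists>a. {a, x} \<in> E \<and> {a, y} \<in> E \<and> c a \<noteq> c x)"
  obtains f :: "bool \<Rightarrow> 'a set \<Rightarrow> 'a set"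
  where "\<And>e g. e \<in> E \<Longrightarrow> g \<in> E \<Longrightarrow> e \<noteq> g \<Longrightarrow>
    e \<inter> g \<noteq> {} \<longleftrightarrow> f True e = f True g \<or> f False e = f False g"
proof -
  \<comment> \<open>A label shared by the two ends of a monochromatic edge. By \<open>r_base\<close>
    it is then exactly this edge; otherwise it is \<open>{x}\<close> when no monochromatic edge
    meets \<open>x\<close>.\<close>
  define r where "r x = insert x {y. {x, y} \<in> E \<and> c x = c y}" for x
  have apex: "\<exists>a. c a \<noteq> c x \<and> (\<forall>e\<in>E. x \<in> e \<longrightarrow> e = {a, x} \<or> e = {x, y}) \<and>
      (\<forall>e\<in>E. y \<in> e \<longrightarrow> e = {a, y} \<or> e = {x, y})"
    if xy: "{x, y} \<in> E" "c x = c y" for x y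
  proof -
    obtain a where a: "{a, x} \<in> E" "{a, y} \<in> E" "c a \<noteq> c x"
      and d: "degree E x \<le> 2" "degree E y \<le> 2" using col[OF xy] by blast
    have yx: "{y, x} \<in> E" using xy(1) by (simp add: insert_commute)
    have "a \<noteq> x" "a \<noteq> y" using a(3) xy(2) by auto
    then have "e = {a, x} \<or> e = {x, y}" if "e \<in> E" "x \<in> e" for e
      using degree_le_2_edges[OF assms(1) d(1) a(1) xy(1) _ that] by blast
    moreover have "e = {a, y} \<or> e = {x, y}" if "e \<in> E" "y \<in> e" for e
      using degree_le_2_edges[OF assms(1) d(2) a(2) yx _ that] \<open>a \<noteq> x\<close> by (auto simp: insert_commute)
    ultimately show ?thesis using a(3) by blast
  qed
  \<comment> \<open>The only other edge at \<open>x\<close> leads to the apex, which has the other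
    colour, so monochromatic edges form a matching.\<close>
  have r_base: "r x = {x, y}" if xy: "{x, y} \<in> E" "c x = c y" for x y
  proof -
    obtain a where a: "c a \<noteq> c x" "\<And>e. e \<in> E \<Longrightarrow> x \<in> e \<Longrightarrow> e = {a, x} \<or> e = {x, y}"
      using apex[OF xy] by blast
    have "z = y" if "{x, z} \<in> E" "c x = c z" for z
      using a(2)[OF that(1)] a(1) that(2) by (auto simp: doubleton_eq_iff)
    then show ?thesis using xy unfolding r_def by blast
  qed
  have r_edge: "r x = r y" if "e \<in> E" "x \<in> e" "y \<in> e" "c x = c y" for e x y
  proof (cases "x = y")
    case False
    then have "e = {x, y}" using that card2[OF that(1)] by (auto simp: card_2_iff)
    then show ?thesis using r_base[of x y] r_base[of y x] that by (auto simp: insert_commute)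
  qed simp
  have r_meet: "e \<inter> g \<noteq> {}"
    if eg: "e \<in> E" "x \<in> e" "g \<in> E" "y \<in> g" "r x = r y" for e g x y
  proof (cases "x = y")
    case False
    then have xy: "{x, y} \<in> E" "c x = c y"
      using that(5) unfolding r_def by (auto simp: insert_commute)
    obtain a where "\<forall>e\<in>E. x \<in> e \<longrightarrow> e = {a, x} \<or> e = {x, y}"
      "\<forall>e\<in>E. y \<in> e \<longrightarrow> e = {a, y} \<or> e = {x, y}" using apex[OF xy] by blast
    then have "e = {a, x} \<or> e = {x, y}" "g = {a, y} \<or> g = {x, y}" using eg by blast+
    then show ?thesis by auto
  qed (use that in blast)
  \<comment> \<open>By \<open>r_edge\<close> the choice of the end does not matter. An edge without
    an end of colour \<open>i\<close> gets itself as value, to be alone in its class.\<close>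
  define f where "f i e = (if \<exists>x\<in>e. c x = i then r (SOME x. x \<in> e \<and> c x = i) else e)" for i e
  have f_r: "f (c x) e = r x" if "e \<in> E" "x \<in> e" for e x
  proof -
    let ?s = "SOME y. y \<in> e \<and> c y = c x"
    have "?s \<in> e \<and> c ?s = c x" by (rule someI[of _ x]) (use that in simp)
    then have "r ?s = r x" using r_edge[OF that(1), of ?s x] that by blast
    then show ?thesis using that unfolding f_def by auto
  qed
  have r_self: "x \<in> r x" for x
    by (simp add: r_def)
  have f_meet: "e \<inter> g \<noteq> {}" if "e \<in> E" "g \<in> E" "e \<noteq> g" "f i e = f i g" for e g i
  proof -
    consider (both) x y where "x \<in> e" "c x = i" "y \<in> g" "c y = i"
      | (left) x where "x \<in> e" "c x = i" "\<forall>y\<in>g. c y \<noteq> i"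
      | (right) y where "\<forall>x\<in>e. c x \<noteq> i" "y \<in> g" "c y = i"
      | (none) "\<forall>x\<in>e. c x \<noteq> i" "\<forall>y\<in>g. c y \<noteq> i" by blast
    then show ?thesis
    proof cases
      case both
      then have "r x = r y" using f_r[OF that(1) both(1)] f_r[OF that(2) both(3)] that(4) by simp
      then show ?thesis using r_meet both that by blast
    next
      case left
      \<comment> \<open>A default value cannot collide with a label: \<open>x\<close> lies in
        \<open>r x\<close>, hence would lie in \<open>g\<close>, which has no vertex of colour
        \<open>i\<close>.\<close>
      then have "r x = g" using f_r[of e x] that unfolding f_def[of i g] by auto
      then show ?thesis using left r_self[of x] by blast
    next
      case right
      then have "r y = e" using f_r[of g y] that unfolding f_def[of i e] by auto
      then show ?thesis using right r_self[of y] by blast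
    next
      case none
      then have "f i e = e" "f i g = g" unfolding f_def by auto
      then show ?thesis using that by simp
    qed
  qed
  show ?thesis
  proof (rule that[of f])
    fix e g assume eg: "e \<in> E" "g \<in> E" "e \<noteq> g"
    show "e \<inter> g \<noteq> {} \<longleftrightarrow> f True e = f True g \<or> f False e = f False g"
    proof
      assume "e \<inter> g \<noteq> {}"
      then obtain x where "x \<in> e" "x \<in> g" by blast
      then have "f (c x) e = f (c x) g" using f_r eg by simp
      then show "f True e = f True g \<or> f False e = f False g" by (cases "c x") auto
    qed (use f_meet[OF eg] in blast)
  qed
qed

theorem theorem2:
  fixes V :: "'a set" and E :: "'a set set"
  assumes "simple_graph V E"
  shows "(\<exists>\<M>\<^sub>1 \<M>\<^sub>2. matroid E \<M>\<^sub>1 \<and> matroid E \<M>\<^sub>2 \<and> matchings E = \<M>\<^sub>1 \<inter> \<M>\<^sub>2)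
    \<longleftrightarrow> \<not> (\<exists>vs. cycle E vs \<and> odd (length vs) \<and> length vs \<ge> 5) \<and>
        (\<forall>vs. triangle E vs \<longrightarrow> card {v \<in> set vs. degree E v > 2} \<le> 1)"
    (is "?matroids \<longleftrightarrow> ?odd \<and> ?tri")
proof
  have card2: "\<And>e. e \<in> E \<Longrightarrow> card e = 2" and "E \<subseteq> Pow V" "finite V"
    using assms by (auto simp: simple_graph_def)
  then have fin: "finite E" by (meson finite_Pow_iff finite_subset)
  {
    assume ?matroids
    then obtain M1 M2 where M: "matroid E M1" "matroid E M2" "matchings E = M1 \<inter> M2"
      by blast
    obtain f1 f2 :: "'a set \<Rightarrow> 'a set set" where
      cls: "\<And>e g. e \<in> E \<Longrightarrow> g \<in> E \<Longrightarrow> e \<noteq> g \<Longrightarrow> e \<inter> g \<noteq> {} \<longleftrightarrow> f1 e = f1 g \<or> f2 e = f2 g"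
      using matchings_intersection_imp_classes[OF M] by blast
    have ?odd using classes_imp_no_odd_cycle[OF cls] by blast
    moreover have "card {v \<in> set vs. degree E v > 2} \<le> 1" if "triangle E vs" for vs
    proof -
      have two: "degree E b \<le> 2"
        if "{a, b} \<in> E" "{b, d} \<in> E" "{a, d} \<in> E" "degree E a > 2" for a b d
        using classes_imp_triangle_degree[OF cls card2] that by blast
      \<comment> \<open>Any two distinct vertices of the triangle, with the remaining one as
        \<open>w\<close>, can play the roles of \<open>a\<close> and \<open>b\<close> in
        \<open>two\<close>.\<close>
      have "u = v" if "u \<in> set vs" "degree E u > 2" "v \<in> set vs" "degree E v > 2" for u v
      proof (rule ccontr)
        assume "u \<noteq> v"
        obtain p q r where vs: "vs = [p, q, r]"
          using \<open>triangle E vs\<close> by (rule triangle_obtains)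
        have edges: "{p, q} \<in> E" "{q, r} \<in> E" "{p, r} \<in> E"
          using \<open>triangle E vs\<close> unfolding vs triangle_iff by auto
        have "\<exists>w. {u, v} \<in> E \<and> {v, w} \<in> E \<and> {u, w} \<in> E"
          using \<open>u \<noteq> v\<close> that(1,3) edges unfolding vs by (auto simp: insert_commute)
        then show False using two that(2,4) by (meson not_le)
      qed
      then show ?thesis by (auto simp: card_le_Suc0_iff_eq)
    qed
    ultimately show "?odd \<and> ?tri" by blast
  next
    assume "?odd \<and> ?tri"
    then have odd: "\<And>vs. cycle E vs \<Longrightarrow> odd (length vs) \<Longrightarrow> length vs < 5"
      and tri: "\<And>vs. triangle E vs \<Longrightarrow> card {v \<in> set vs. degree E v > 2} \<le> 1"
      by (auto simp: not_le[symmetric])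
    obtain c :: "'a \<Rightarrow> bool" where c: "\<And>x y. {x, y} \<in> E \<Longrightarrow> c x = c y \<Longrightarrow>
      degree E x \<le> 2 \<and> degree E y \<le> 2 \<and> (\<exists>a. {a, x} \<in> E \<and> {a, y} \<in> E \<and> c a \<noteq> c x)"
      using two_colouring_up_to_triangle_bases[OF fin card2 odd tri] by blast
    obtain f :: "bool \<Rightarrow> 'a set \<Rightarrow> 'a set" where
      "\<And>e g. e \<in> E \<Longrightarrow> g \<in> E \<Longrightarrow> e \<noteq> g \<Longrightarrow>
        e \<inter> g \<noteq> {} \<longleftrightarrow> f True e = f True g \<or> f False e = f False g"
      using two_colouring_imp_classes[OF fin card2 c] by blast
    then show ?matroids by (rule classes_imp_matchings_intersection[OF fin])
  }
qed

end
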